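(* Let $H = Z_n$ be a finite cyclic group of order $n > 1$, assume that $m\text{-}G(H)$ is connected for some integer $m > 1$, and let $k=\gcd(m,n)$. Then $m\text{-}G(H)$ is a tree, and hence its chromatic number is $2$; likewise $k\text{-}G(H)$ is a tree, and hence its chromatic number is $2$.
   Context: $Z_n$ is the additive cyclic group of integers modulo $n$. For an integer $r>1$, the graph $r\text{-}G(Z_n)$ is the simple undirected graph with vertex set $Z_n$ in which two distinct vertices $a,b$ are adjacent if and only if $ra=b$ or $rb=a$ in $Z_n$. A tree is a connected graph with no cycles. *)

theory Defs
  imports "HOL-Algebra.Elementary_Groups" "Graph_Theory.Graph_Theory"
begin

text \<open>
  Simple undirected graphs are symmetric loop-free digraphs: an edge is a pair of opposite arcs.
  In a group \<open>H\<close> written multiplicatively, the multiple \<open>ra\<close> of the additive notation is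
  \<open>a [^]\<^bsub>H\<^esub> r\<close>.
\<close>

definition r_graph :: "nat \<Rightarrow> ('a, 'b) monoid_scheme \<Rightarrow> 'a pair_pre_digraph" where
  "r_graph r H =
    \<lparr> pverts = carrier H,
      parcs = {(a, b). a \<in> carrier H \<and> b \<in> carrier H \<and> a \<noteq> b \<and>
                       (a [^]\<^bsub>H\<^esub> r = b \<or> b [^]\<^bsub>H\<^esub> r = a)} \<rparr>"

lemma pair_graph_r_graph:
  assumes "finite (carrier H)"
  shows "pair_graph (r_graph r H)"
proof
  have "parcs (r_graph r H) \<subseteq> carrier H \<times> carrier H"
    by (auto simp: r_graph_def)
  then show "finite (parcs (r_graph r H))"
    using assms by (meson finite_SigmaI finite_subset)
  show "symmetric (with_proj (r_graph r H))"
    by (auto simp: symmetric_def r_graph_def sym_def)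
qed (use assms in \<open>auto simp: r_graph_def\<close>)

text \<open>
  In a symmetric digraph \<^const>\<open>pre_digraph.cycle\<close> also holds for the closed walk that traverses
  one edge back and forth, so the library's \<^const>\<open>tree\<close> fails for every symmetric graph with an
  edge. A cycle of an undirected graph has at least three edges.
\<close>

definition undirected_cycle :: "('a, 'b) pre_digraph \<Rightarrow> 'b awalk \<Rightarrow> bool" where
  "undirected_cycle G p \<longleftrightarrow> pre_digraph.cycle G p \<and> 3 \<le> length p"

definition undirected_tree :: "('a, 'b) pre_digraph \<Rightarrow> bool" where
  "undirected_tree G \<longleftrightarrow> Digraph_Component.connected G \<and> \<not> (\<exists>p. undirected_cycle G p)"

definition proper_colouring :: "('a, 'b) pre_digraph \<Rightarrow> nat \<Rightarrow> ('a \<Rightarrow> nat) \<Rightarrow> bool" where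
  "proper_colouring G c f \<longleftrightarrow>
    f ` verts G \<subseteq> {..<c} \<and> (\<forall>e\<in>arcs G. f (tail G e) \<noteq> f (head G e))"

text \<open>Meaningful only if some proper colouring exists, as for every finite loop-free graph.\<close>

definition chromatic_number :: "('a, 'b) pre_digraph \<Rightarrow> nat" where
  "chromatic_number G = (LEAST c. \<exists>f. proper_colouring G c f)"

end

theory Submission
  imports Defs
begin

text \<open>
  Two distinct elements of \<open>H\<close> are adjacent when one is the image of the other under the power map
  \<open>a \<mapsto> a [^] r\<close>, which fixes the identity. Any walk therefore stays inside or outside the set of
  elements that iterates of the power map send to the identity. So the graph is connected iff the
  power map is nilpotent, i.e. iff every element is sent to \<open>\<one>\<close> by some iterate
  (\<open>connected_r_graph_iff\<close>).

  In that case the picture is a rooted tree: the root is \<open>\<one>\<close>, the parent of \<open>a \<noteq> \<one>\<close> is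
  \<open>a [^] r\<close>, and the number of iterations needed to reach \<open>\<one>\<close> is the distance to the root
  (\<open>r_graph_arc_cases\<close>). Every edge joins a vertex to its unique parent, one level closer to the
  root. A vertex of a cycle at maximal level would have two distinct neighbours one level below,
  hence two parents; so there is no cycle (\<open>no_undirected_cycle_if_parent\<close>). The parity of the
  level is a proper 2-colouring (\<open>chromatic_number_eq_2_if_levels\<close>).

  For \<open>Z\<^sub>n\<close> the power map is multiplication by \<open>r\<close>, which is nilpotent iff \<open>n\<close> divides a power of
  \<open>r\<close>. If \<open>n\<close> divides \<open>m ^ i\<close>, then it divides
  \<open>gcd (m ^ i) (n ^ i) = (gcd m n) ^ i\<close> as well, so the graph of \<open>k\<close> is
  connected too and the same argument applies to it.
\<close>

section \<open>Graphs in which every edge joins a vertex to its parent\<close>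

lemma (in pre_digraph) cas_nth:
  assumes "cas u p v" and "i < length p"
  shows "tail G (p ! i) = (if i = 0 then u else head G (p ! (i - 1)))"
  using assms by (induction u p v arbitrary: i rule: cas.induct) (auto simp: nth_Cons split: nat.splits)

lemma (in pre_digraph) cas_head_last:
  assumes "cas u p v" and "p \<noteq> []"
  shows "head G (last p) = v"
  using assms by (induction u p v rule: cas.induct) auto

lemma (in pre_digraph) closed_cas_nth:
  assumes "cas u p u" and "i < length p"
  shows "tail G (p ! (Suc i mod length p)) = head G (p ! i)"
proof (cases "Suc i < length p")
  case True
  then show ?thesis
    using cas_nth[OF assms(1), of "Suc i"] by simp
next
  case False
  with assms(2) have last: "Suc i = length p" by simp
  then have "head G (p ! i) = u"
    using cas_head_last[OF assms(1)] assms(2)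
    by (metis diff_Suc_1 last_conv_nth length_0_conv less_nat_zero_code)
  then show ?thesis
    using last cas_nth[OF assms(1), of 0] assms(2) by (cases p) auto
qed

text \<open>
  The arcs into and out of a vertex of maximal level on a cycle both join it to its parent.
  Going around the cycle, the vertices just before and just after it are then equal, which is
  possible for distinct vertices only if the cycle has length at most two.
\<close>

lemma no_undirected_cycle_if_parent:
  fixes level :: "'a \<Rightarrow> nat"
  assumes arcs: "\<And>e. e \<in> arcs G \<Longrightarrow>
      head G e = parent (tail G e) \<and> level (tail G e) = Suc (level (head G e)) \<or>
      tail G e = parent (head G e) \<and> level (head G e) = Suc (level (tail G e))"
  shows "\<not> undirected_cycle G p"
proof
  interpret pre_digraph G .
  assume "undirected_cycle G p"
  then obtain u where walk: "set p \<subseteq> arcs G" "cas u p u"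
    and dist: "distinct (tl (awalk_verts u p))" and len: "3 \<le> length p"
    by (auto simp: undirected_cycle_def cycle_def awalk_def)
  define L where "L = length p"
  have "p \<noteq> []" using len by auto
  with dist walk have heads: "distinct (map (head G) p)"
    using awalk_verts_conv' by simp
  have next_arc: "tail G (p ! (Suc i mod L)) = head G (p ! i)" if "i < L" for i
    using that closed_cas_nth[OF walk(2)] by (simp add: L_def)
  obtain j where j: "j < L"
    and max: "\<And>i. i < L \<Longrightarrow> level (head G (p ! i)) \<le> level (head G (p ! j))"
    using Max_in[of "(\<lambda>i. level (head G (p ! i))) ` {..<L}"]
      Max_ge[of "(\<lambda>i. level (head G (p ! i))) ` {..<L}"] len
    by (fastforce simp: L_def lessThan_empty_iff)
  define v where "v = head G (p ! j)"
  \<comment> \<open>The cyclic predecessor of \<open>j\<close>, written without subtraction below zero.\<close>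
  define h where "h = (j + (L - 1)) mod L"
  define i where "i = Suc j mod L"
  have "h < L" "i < L" using j by (auto simp: h_def i_def)
  have "Suc h mod L = j" using j by (simp add: h_def mod_Suc_eq)
  then have before: "tail G (p ! j) = head G (p ! h)"
    using next_arc[OF \<open>h < L\<close>] by simp
  have after: "tail G (p ! i) = v"
    using next_arc[OF j] by (simp add: i_def v_def)
  have "head G (p ! h) = parent v"
    using arcs[of "p ! j"] max[OF \<open>h < L\<close>] walk(1) j before
    by (auto simp: v_def L_def subset_iff)
  moreover have "head G (p ! i) = parent v"
    using arcs[of "p ! i"] max[OF \<open>i < L\<close>] walk(1) \<open>i < L\<close> after
    by (auto simp: v_def L_def subset_iff)
  ultimately have "h = i"
    using nth_eq_iff_index_eq[OF heads, of h i] \<open>h < L\<close> \<open>i < L\<close> by (simp add: L_def)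
  \<comment> \<open>Then \<open>j - 1\<close> and \<open>j + 1\<close> agree modulo the length of the cycle, which would divide 2.\<close>
  then have "Suc (Suc j mod L) mod L = j"
    using \<open>Suc h mod L = j\<close> by (simp add: i_def)
  then show False
    using j len by (auto simp: L_def mod_Suc split: if_splits)
qed

text \<open>
  Every arc joins consecutive levels, so the parity of the level separates its ends. The given arc
  \<open>e\<close> rules out a colouring with a single colour.
\<close>

lemma chromatic_number_eq_2_if_levels:
  fixes level :: "'a \<Rightarrow> nat"
  assumes arcs: "\<And>e. e \<in> arcs G \<Longrightarrow>
      level (tail G e) = Suc (level (head G e)) \<or> level (head G e) = Suc (level (tail G e))"
    and e: "e \<in> arcs G" "tail G e \<in> verts G" "head G e \<in> verts G"
  shows "chromatic_number G = 2"
  unfolding chromatic_number_def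
proof (rule Least_equality)
  have "proper_colouring G 2 (\<lambda>v. level v mod 2)"
    unfolding proper_colouring_def
  proof (intro conjI ballI)
    fix e assume "e \<in> arcs G"
    from arcs[OF this] show "level (tail G e) mod 2 \<noteq> level (head G e) mod 2"
      by presburger
  qed auto
  then show "\<exists>f. proper_colouring G 2 f" by blast
next
  fix c assume "\<exists>f. proper_colouring G c f"
  then obtain f where "f ` verts G \<subseteq> {..<c}" "f (tail G e) \<noteq> f (head G e)"
    using e(1) by (auto simp: proper_colouring_def)
  then have "f (tail G e) < c" "f (head G e) < c" "f (tail G e) \<noteq> f (head G e)"
    using e by auto
  then show "2 \<le> c" by linarith
qed

section \<open>Power graphs with nilpotent power map\<close>

text \<open>
  The number of times the \<open>r\<close>-th power map must be applied to \<open>a\<close> to reach the identity; an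
  arbitrary number if no iterate does.
\<close>

definition power_level :: "nat \<Rightarrow> ('a, 'b) monoid_scheme \<Rightarrow> 'a \<Rightarrow> nat" where
  "power_level r H a = (LEAST i. a [^]\<^bsub>H\<^esub> (r ^ i) = \<one>\<^bsub>H\<^esub>)"

lemma arcs_r_graph_iff:
  "(a, b) \<in> parcs (r_graph r H) \<longleftrightarrow> a \<in> carrier H \<and> b \<in> carrier H \<and> a \<noteq> b \<and>
     (a [^]\<^bsub>H\<^esub> r = b \<or> b [^]\<^bsub>H\<^esub> r = a)"
  by (simp add: r_graph_def)

lemma verts_r_graph: "pverts (r_graph r H) = carrier H"
  by (simp add: r_graph_def)

lemma symcl_arcs_r_graph: "(parcs (r_graph r H))\<^sup>s = parcs (r_graph r H)"
  by (auto simp: symcl_def r_graph_def)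

lemma (in monoid) pow_power_Suc:
  fixes r :: nat
  assumes "a \<in> carrier G"
  shows "a [^] (r ^ Suc i) = (a [^] r) [^] (r ^ i)"
  using assms by (simp add: nat_pow_pow)

lemma (in monoid) pow_power_one_iff:
  fixes r :: nat
  assumes "a \<in> carrier G"
  shows "(\<exists>i. (a [^] r) [^] (r ^ i) = \<one>) \<longleftrightarrow> (\<exists>i. a [^] (r ^ i) = \<one>)"
proof
  assume "\<exists>i. a [^] (r ^ i) = \<one>"
  then obtain i where i: "a [^] (r ^ i) = \<one>" ..
  have "(a [^] r) [^] (r ^ i) = (a [^] (r ^ i)) [^] r"
    using assms by (simp add: nat_pow_pow mult.commute)
  with i show "\<exists>i. (a [^] r) [^] (r ^ i) = \<one>" by auto
qed (use assms pow_power_Suc in metis)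

text \<open>
  For the forward direction, having an iterate equal to \<open>\<one>\<close> is invariant along edges and holds
  at \<open>\<one>\<close>. Conversely, iterating the power map gives a walk to \<open>\<one>\<close>, so all vertices are connected
  through \<open>\<one>\<close>.
\<close>

lemma (in monoid) connected_r_graph_iff:
  "Digraph_Component.connected (with_proj (r_graph r G)) \<longleftrightarrow>
     (\<forall>a\<in>carrier G. \<exists>i. a [^] (r ^ i) = \<one>)"
proof -
  define R where "R = rtrancl_on (carrier G) (parcs (r_graph r G))"
  have conn: "Digraph_Component.connected (with_proj (r_graph r G)) \<longleftrightarrow>
      (\<forall>a\<in>carrier G. \<forall>b\<in>carrier G. (a, b) \<in> R)"
    by (auto simp: connected_conv verts_r_graph symcl_arcs_r_graph R_def)
  have "sym R"
    unfolding R_def by (rule rtrancl_on_sym) (auto simp: sym_def arcs_r_graph_iff)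
  have "\<exists>i. a [^] (r ^ i) = \<one>" if "(\<one>, a) \<in> R" for a
    using that unfolding R_def
  proof (induction rule: rtrancl_on_induct)
    case base
    have "\<one> [^] (r ^ 0) = \<one>" by simp
    then show ?case by blast
  next
    case (step y z)
    then show ?case using pow_power_one_iff by (auto simp: arcs_r_graph_iff)
  qed
  moreover have "(a, \<one>) \<in> R" if "a \<in> carrier G" "a [^] (r ^ i) = \<one>" for a i
    using that
  proof (induction i arbitrary: a)
    case 0
    then show ?case by (simp add: R_def)
  next
    case (Suc i)
    then have "(a [^] r, \<one>) \<in> R" by (simp add: pow_power_Suc del: power_Suc)
    moreover have "a = a [^] r \<or> (a, a [^] r) \<in> parcs (r_graph r G)"
      using Suc.prems(1) by (simp add: arcs_r_graph_iff)
    ultimately show ?case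
      using Suc.prems(1) converse_rtrancl_on_into_rtrancl_on unfolding R_def by metis
  qed
  ultimately show ?thesis
    unfolding conn using \<open>sym R\<close> rtrancl_on_trans[of _ \<one> "carrier G"] R_def
    by (metis one_closed symD)
qed

lemma (in monoid) power_level_Suc:
  fixes r :: nat
  assumes "a \<in> carrier G" "a \<noteq> \<one>" "\<exists>i. a [^] (r ^ i) = \<one>"
  shows "power_level r G a = Suc (power_level r G (a [^] r))"
proof -
  obtain i where "a [^] (r ^ i) = \<one>" using assms(3) ..
  moreover have "a [^] (r ^ 0) \<noteq> \<one>" using assms by simp
  ultimately have "(LEAST i. a [^] (r ^ i) = \<one>) = Suc (LEAST i. a [^] (r ^ Suc i) = \<one>)"
    by (rule Least_Suc)
  then show ?thesis
    using assms(1) by (simp add: power_level_def pow_power_Suc del: power_Suc)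
qed

text \<open>
  An arc whose end \<open>b\<close> is the power of its end \<open>a\<close> cannot have \<open>a = \<one>\<close>, since \<open>\<one>\<close> is its own
  power and loops are excluded. Hence \<open>power_level_Suc\<close> applies to every arc.
\<close>

lemma (in monoid) r_graph_arc_cases:
  assumes "Digraph_Component.connected (with_proj (r_graph r G))"
    and "(a, b) \<in> parcs (r_graph r G)"
  shows "b = a [^] r \<and> power_level r G a = Suc (power_level r G b) \<or>
         a = b [^] r \<and> power_level r G b = Suc (power_level r G a)"
proof -
  have "power_level r G x = Suc (power_level r G (x [^] r))"
    if "x \<in> carrier G" "x [^] r \<noteq> x" for x
    using that assms(1) by (intro power_level_Suc) (auto simp: connected_r_graph_iff)
  with assms(2) show ?thesis by (auto simp: arcs_r_graph_iff)
qed

lemma (in monoid) undirected_tree_r_graph: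
  assumes "Digraph_Component.connected (with_proj (r_graph r G))"
  shows "undirected_tree (with_proj (r_graph r G))"
proof -
  have "\<not> undirected_cycle (with_proj (r_graph r G)) p" for p
    by (rule no_undirected_cycle_if_parent[where parent = "\<lambda>a. a [^] r" and level = "power_level r G"])
      (use r_graph_arc_cases[OF assms] in auto)
  with assms show ?thesis by (simp add: undirected_tree_def)
qed

text \<open>
  The only point beyond the parity colouring is that an edge exists: a vertex other than \<open>\<one>\<close> is
  joined to its power, because it is not a fixed point of a nilpotent power map.
\<close>

lemma (in monoid) chromatic_number_r_graph:
  assumes "Digraph_Component.connected (with_proj (r_graph r G))"
    and "a \<in> carrier G" "a \<noteq> \<one>"
  shows "chromatic_number (with_proj (r_graph r G)) = 2"
proof (rule chromatic_number_eq_2_if_levels[where level = "power_level r G"])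
  have "power_level r G a = Suc (power_level r G (a [^] r))"
    using assms by (intro power_level_Suc) (auto simp: connected_r_graph_iff)
  then have "a \<noteq> a [^] r" by auto
  then show "(a, a [^] r) \<in> arcs (with_proj (r_graph r G))"
    using assms by (simp add: arcs_r_graph_iff)
next
  fix e assume "e \<in> arcs (with_proj (r_graph r G))"
  then show "power_level r G (tail (with_proj (r_graph r G)) e) =
        Suc (power_level r G (head (with_proj (r_graph r G)) e)) \<or>
      power_level r G (head (with_proj (r_graph r G)) e) =
        Suc (power_level r G (tail (with_proj (r_graph r G)) e))"
    using r_graph_arc_cases[OF assms(1), of "fst e" "snd e"] by auto
qed (use assms in \<open>auto simp: verts_r_graph\<close>)

section \<open>Finite cyclic groups\<close>

text \<open>
  Nilpotency of multiplication by \<open>r\<close> on \<open>Z\<^sub>n\<close> is decided at the generator 1, where it says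
  that some \<open>r ^ i\<close> vanishes modulo \<open>n\<close>.
\<close>

lemma connected_r_graph_integer_mod_group_iff:
  assumes "n > 1"
  shows "Digraph_Component.connected (with_proj (r_graph r (integer_mod_group n))) \<longleftrightarrow>
         (\<exists>i. n dvd r ^ i)"
proof -
  interpret group "integer_mod_group n" by simp
  have kill_iff: "a [^]\<^bsub>integer_mod_group n\<^esub> (r ^ i) = \<one>\<^bsub>integer_mod_group n\<^esub> \<longleftrightarrow>
      int n dvd int (r ^ i) * a" for a i
    by (simp add: dvd_eq_mod_eq_0)
  show ?thesis
  proof
    assume "Digraph_Component.connected (with_proj (r_graph r (integer_mod_group n)))"
    moreover have "1 \<in> carrier (integer_mod_group n)" using assms by simp
    ultimately obtain i where "int n dvd int (r ^ i) * 1"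
      unfolding connected_r_graph_iff kill_iff by blast
    then show "\<exists>i. n dvd r ^ i" unfolding mult_1_right int_dvd_int_iff ..
  next
    assume "\<exists>i. n dvd r ^ i"
    then obtain i where "int n dvd int (r ^ i)" unfolding int_dvd_int_iff ..
    then show "Digraph_Component.connected (with_proj (r_graph r (integer_mod_group n)))"
      unfolding connected_r_graph_iff kill_iff using dvd_mult2 by blast
  qed
qed

theorem theorem3p4:
  fixes n m k :: nat
  assumes "n > 1" and "m > 1"
    and "Digraph_Component.connected (with_proj (r_graph m (integer_mod_group n)))"
    and "k = gcd m n"
  shows "undirected_tree (with_proj (r_graph m (integer_mod_group n))) \<and>
         chromatic_number (with_proj (r_graph m (integer_mod_group n))) = 2 \<and>
         undirected_tree (with_proj (r_graph k (integer_mod_group n))) \<and>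
         chromatic_number (with_proj (r_graph k (integer_mod_group n))) = 2"
proof -
  interpret group "integer_mod_group n" by simp
  have one: "1 \<in> carrier (integer_mod_group n)" "1 \<noteq> \<one>\<^bsub>integer_mod_group n\<^esub>"
    using assms(1) by simp_all
  obtain i where i: "n dvd m ^ i"
    using assms(3) connected_r_graph_integer_mod_group_iff[OF assms(1)] by blast
  with assms(1) have "i \<noteq> 0" by (auto intro: ccontr)
  then have "n dvd n ^ i" by (simp add: dvd_power)
  with i have "n dvd gcd (m ^ i) (n ^ i)" by (rule gcd_greatest)
  then have "n dvd k ^ i" by (simp add: assms(4))
  then have "Digraph_Component.connected (with_proj (r_graph k (integer_mod_group n)))"
    using connected_r_graph_integer_mod_group_iff[OF assms(1)] by blast
  with assms(3) one show ?thesis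
    by (intro conjI undirected_tree_r_graph chromatic_number_r_graph)
qed

end
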